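(* Let $\beta>\alpha>0$ and let $D:F_\alpha^2\to F_\beta^2$ be the bounded operator $Df=f'$. For $k\ge0$ let $c_k=\left(\frac{k!}{\alpha^k}\right)^{1/2}$, $d_k=\left(\frac{k!}{\beta^k}\right)^{1/2}$, $e_k(z)=\frac{z^k}{c_k}$ and $E_k(z)=\frac{z^k}{d_k}$, so that $(e_k)_{k\ge0}$ and $(E_k)_{k\ge0}$ are orthonormal bases of $F_\alpha^2$ and $F_\beta^2$ respectively. Then the adjoint operator $D^*:F_\beta^2\to F_\alpha^2$ is given, for $g=\sum_{k=0}^\infty g_kE_k\in F_\beta^2$ with $(g_k)_k\in l^2$, by $$D^*g=\sum_{k\ge1}k\,\frac{d_{k-1}}{c_k}\,g_{k-1}\,e_k.$$
   Context: For $\alpha>0$, the Fock space $F_\alpha^2$ is the Hilbert space of all entire functions $f$ with $\frac{\alpha}{\pi}\int_{\mathbb{C}}|f(z)|^2e^{-\alpha|z|^2}\,dA(z)<\infty$, with inner product $(f,g)_\alpha=\frac{\alpha}{\pi}\int_{\mathbb{C}}f(z)\overline{g(z)}e^{-\alpha|z|^2}\,dA(z)$, where $dA$ is Lebesgue measure on $\mathbb{C}$; $F_\beta^2$ and $(\cdot,\cdot)_\beta$ are defined in the same way with $\beta$ in place of $\alpha$. The adjoint is defined by $(Df,g)_\beta=(f,D^*g)_\alpha$ for all $f\in F_\alpha^2$, $g\in F_\beta^2$. *)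

theory Defs
  imports "HOL-Complex_Analysis.Complex_Analysis"
begin

definition fock_space :: "real \<Rightarrow> (complex \<Rightarrow> complex) set" where
  "fock_space \<alpha> = {f. f holomorphic_on UNIV \<and>
     integrable lborel (\<lambda>z. (norm (f z))\<^sup>2 * exp (- \<alpha> * (norm z)\<^sup>2))}"

definition fock_inner :: "real \<Rightarrow> (complex \<Rightarrow> complex) \<Rightarrow> (complex \<Rightarrow> complex) \<Rightarrow> complex" where
  "fock_inner \<alpha> f g = complex_of_real (\<alpha> / pi) *
     (LINT z|lborel. f z * cnj (g z) * complex_of_real (exp (- \<alpha> * (norm z)\<^sup>2)))"

definition fock_norm :: "real \<Rightarrow> (complex \<Rightarrow> complex) \<Rightarrow> real" where
  "fock_norm \<alpha> f = sqrt (Re (fock_inner \<alpha> f f))"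

definition fock_sums :: "real \<Rightarrow> (nat \<Rightarrow> complex \<Rightarrow> complex) \<Rightarrow> (complex \<Rightarrow> complex) \<Rightarrow> bool" where
  "fock_sums \<alpha> u f \<longleftrightarrow> f \<in> fock_space \<alpha> \<and> (\<forall>k. u k \<in> fock_space \<alpha>) \<and>
     (\<lambda>n. fock_norm \<alpha> (\<lambda>z. f z - (\<Sum>k<n. u k z))) \<longlonglongrightarrow> 0"

definition fock_orthonormal_basis :: "real \<Rightarrow> (nat \<Rightarrow> complex \<Rightarrow> complex) \<Rightarrow> bool" where
  "fock_orthonormal_basis \<alpha> u \<longleftrightarrow>
     (\<forall>k. u k \<in> fock_space \<alpha>) \<and>
     (\<forall>j k. fock_inner \<alpha> (u j) (u k) = (if j = k then 1 else 0)) \<and>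
     (\<forall>f \<in> fock_space \<alpha>. \<forall>\<epsilon>>0. \<exists>n. \<exists>a :: nat \<Rightarrow> complex.
        fock_norm \<alpha> (\<lambda>z. f z - (\<Sum>k<n. a k * u k z)) < \<epsilon>)"

definition fock_bounded_operator ::
    "real \<Rightarrow> real \<Rightarrow> ((complex \<Rightarrow> complex) \<Rightarrow> (complex \<Rightarrow> complex)) \<Rightarrow> bool" where
  "fock_bounded_operator \<alpha> \<beta> T \<longleftrightarrow>
     (\<forall>f \<in> fock_space \<alpha>. T f \<in> fock_space \<beta>) \<and>
     (\<forall>f \<in> fock_space \<alpha>. \<forall>g \<in> fock_space \<alpha>. T (\<lambda>z. f z + g z) = (\<lambda>z. T f z + T g z)) \<and>
     (\<forall>c. \<forall>f \<in> fock_space \<alpha>. T (\<lambda>z. c * f z) = (\<lambda>z. c * T f z)) \<and>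
     (\<exists>C. \<forall>f \<in> fock_space \<alpha>. fock_norm \<beta> (T f) \<le> C * fock_norm \<alpha> f)"

(* Meaningful for g in fock_space \<beta>, where the Riesz representation theorem makes the
   described function exist uniquely when T is bounded from fock_space \<alpha> to fock_space \<beta>. *)
definition fock_adjoint ::
    "real \<Rightarrow> real \<Rightarrow> ((complex \<Rightarrow> complex) \<Rightarrow> (complex \<Rightarrow> complex)) \<Rightarrow>
     (complex \<Rightarrow> complex) \<Rightarrow> (complex \<Rightarrow> complex)" where
  "fock_adjoint \<alpha> \<beta> T g =
     (THE h. h \<in> fock_space \<alpha> \<and> (\<forall>f \<in> fock_space \<alpha>. fock_inner \<beta> (T f) g = fock_inner \<alpha> f h))"

(* With parameter \<alpha> this gives c_k and e_k, with parameter \<beta> it gives d_k and E_k. *)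
definition fock_coeff :: "real \<Rightarrow> nat \<Rightarrow> real" where
  "fock_coeff \<alpha> k = sqrt (fact k / \<alpha> ^ k)"

definition fock_basis :: "real \<Rightarrow> nat \<Rightarrow> complex \<Rightarrow> complex" where
  "fock_basis \<alpha> k z = z ^ k / complex_of_real (fock_coeff \<alpha> k)"

end

(* The monomials are orthogonal on every centred disc for the weight exp(-alpha |z|^2), because the
   weight and Lebesgue measure are rotation invariant. Hence for f = sum a_n z^n the integral of
   |f|^2 exp(-alpha |z|^2) over a disc is a sum of integrals of monomials, and letting the radius
   tend to infinity gives ||f||^2 = sum |a_n|^2 n!/alpha^n, both sides being possibly infinite.
   Everything then happens on Taylor coefficients. Boundedness of D comes from the boundedness of
   (n+1) (alpha/beta)^n, and comparing coefficients gives the closed form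
   (D^* g)(z) = alpha z g(alpha z / beta), whose Taylor series is the asserted expansion. *)
theory Submission
  imports Defs "HOL-Probability.Distributions"
begin

text \<open>Membership in \<open>fock_space \<alpha>\<close> is an integrability claim about an
  entire function of unknown growth, so series and integral cannot be exchanged on the whole plane
  at the outset. On a disc they can, since the partial sums are uniformly bounded there; from discs
  to the plane all terms are nonnegative, so limits are monotone and no finiteness is presupposed.
  Inner products, whose integrands have no sign, are then recovered from norms by polarization. The
  quantity (n+1) \<alpha> (\<alpha>/\<beta>)^n is the square of (n+1) d_n / c_{n+1}, the factor in D
  e_{n+1} = (n+1) (d_n / c_{n+1}) E_n; the hypothesis \<alpha> < \<beta> is what keeps it bounded.
  If f, g and D^* g have Taylor coefficients a_n, b_n and h_n, then the two sides of the adjoint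
  relation are the sums of (n+1) a_{n+1} conj(b_n) d_n^2 and of a_n conj(h_n) c_n^2. Equating them
  for all f forces h_0 = 0 and h_{n+1} = (\<alpha>^(n+1) / \<beta>^n) b_n, which is the origin of
  the closed form.\<close>

subsection \<open>Rotation invariance and Gaussian moments in the plane\<close>

text \<open>Carries Lebesgue measure from \<open>real^2\<close>, where orthogonal transformations
  are known to preserve measure, over to \<open>complex\<close>. Agreement on boxes is enough, and
  the preimage of a box is the box with the same sides.\<close>

lemma distr_lborel_vector_complex:
  "distr lborel borel (\<lambda>v :: real^2. Complex (v$1) (v$2)) = lborel"
proof (rule lborel_eqI[symmetric])
  fix l u :: complex
  assume lu: "\<And>b. b \<in> Basis \<Longrightarrow> l \<bullet> b \<le> u \<bullet> b"
  have meas: "(\<lambda>v :: real^2. Complex (v$1) (v$2)) \<in> borel_measurable borel"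
    unfolding Complex_eq by measurable
  have le: "Re l \<le> Re u" "Im l \<le> Im u"
    using lu[of 1] lu[of \<i>] by (auto simp: Basis_complex_def)
  let ?l = "vector [Re l, Im l] :: real^2" and ?u = "vector [Re u, Im u] :: real^2"
  have B: "Basis = {axis 1 1, axis 2 (1::real) :: real^2}"
    by (auto simp: Basis_vec_def UNIV_2)
  \<comment> \<open>Guarantees that the product over \<open>Basis\<close> has two factors.\<close>
  have ax: "axis 1 1 \<noteq> (axis 2 1 :: real^2)"
    by (simp add: axis_eq_axis)
  have "(\<lambda>v :: real^2. Complex (v$1) (v$2)) -` box l u = box ?l ?u"
    by (auto simp: mem_box B Basis_complex_def inner_axis)
  moreover have "emeasure lborel (box ?l ?u) = ennreal (\<Prod>b\<in>Basis. (?u - ?l) \<bullet> b)"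
    by (rule emeasure_lborel_box) (auto simp: B inner_axis le)
  ultimately show "emeasure (distr lborel borel (\<lambda>v :: real^2. Complex (v$1) (v$2))) (box l u)
      = ennreal (\<Prod>b\<in>Basis. (u - l) \<bullet> b)"
    using ax by (simp add: emeasure_distr meas B inner_axis inner_complex_def Basis_complex_def prod.insert_if)
qed simp

text \<open>In real coordinates, multiplication by a number of modulus 1 is linear and preserves the
  norm, hence is an orthogonal transformation. The maps \<open>\<phi>\<close> and
  \<open>\<psi>\<close> are the mutually inverse coordinate changes.\<close>

lemma distr_lborel_rotation_complex:
  fixes w :: complex
  assumes w: "norm w = 1"
  shows "distr lborel borel (\<lambda>z. w * z) = lborel"
proof (rule lborel_eqI[symmetric])
  fix l u :: complex
  assume lu: "\<And>b. b \<in> Basis \<Longrightarrow> l \<bullet> b \<le> u \<bullet> b"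
  define \<psi> where "\<psi> = (\<lambda>v :: real^2. Complex (v$1) (v$2))"
  define \<phi> where "\<phi> = (\<lambda>z. vector [Re z, Im z] :: real^2)"
  \<comment> \<open>The conjugate appears because the preimage of a box under multiplication by
    \<open>w\<close> is its image under the inverse map, and \<open>w * cnj w = 1\<close>.\<close>
  define T where "T = (\<lambda>v. \<phi> (cnj w * \<psi> v))"
  have \<psi>[measurable]: "\<psi> \<in> borel_measurable borel"
    unfolding \<psi>_def Complex_eq by measurable
  have em: "emeasure lborel X = emeasure lborel (\<psi> -` X)" if "X \<in> sets borel" for X
    using that by (subst distr_lborel_vector_complex[symmetric], subst emeasure_distr)
       (auto simp: \<psi>_def[symmetric])
  have \<psi>\<phi>: "\<psi> (\<phi> z) = z" for z by (simp add: \<psi>_def \<phi>_def)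
  have \<phi>\<psi>: "\<phi> (\<psi> v) = v" for v by (simp add: \<psi>_def \<phi>_def vec_eq_iff forall_2)
  have n\<phi>: "norm (\<phi> z) = norm z" for z
    by (simp add: \<phi>_def norm_vec_def L2_set_def sum_2 cmod_def)
  have n\<psi>: "norm (\<psi> v) = norm v" for v
    using n\<phi>[of "\<psi> v"] \<phi>\<psi> by simp
  have lin: "linear T"
    by (rule linearI)
       (auto simp: T_def \<phi>_def \<psi>_def vec_eq_iff forall_2 algebra_simps)
  have orth: "orthogonal_transformation T"
    using lin w by (simp add: orthogonal_transformation T_def n\<phi> n\<psi> norm_mult)
  have ww: "w * cnj w = 1" using w by (simp add: complex_norm_square[symmetric])
  have meas: "(\<lambda>z. w * z) \<in> borel_measurable lborel" by measurable
  have bx: "box l u \<in> sets borel" by simp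
  have pre: "(\<lambda>z. w * z) -` box l u \<in> sets borel"
    using measurable_sets[OF meas bx] by simp
  have rot: "\<psi> -` ((\<lambda>z. w * z) -` box l u) = T ` (\<psi> -` box l u)"
  proof (intro equalityI subsetI)
    fix v assume v: "v \<in> \<psi> -` ((\<lambda>z. w * z) -` box l u)"
    have "T (\<phi> (w * \<psi> v)) = v"
      using ww by (simp add: T_def \<psi>\<phi> \<phi>\<psi> mult.assoc[symmetric] mult.commute[of "cnj w" w])
    moreover have "\<phi> (w * \<psi> v) \<in> \<psi> -` box l u" using v by (simp add: \<psi>\<phi>)
    ultimately show "v \<in> T ` (\<psi> -` box l u)" by (metis imageI)
  next
    fix v assume "v \<in> T ` (\<psi> -` box l u)"
    then show "v \<in> \<psi> -` ((\<lambda>z. w * z) -` box l u)"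
      by (auto simp: T_def \<psi>\<phi> mult.assoc[symmetric] ww)
  qed
  \<comment> \<open>The facts on orthogonal images concern sets of finite measure and the
    real-valued \<open>measure\<close>; finiteness also allows the return to
    \<open>emeasure\<close>.\<close>
  have "\<psi> -` box l u \<in> lmeasurable"
  proof -
    have "\<psi> -` box l u \<in> sets borel" using measurable_sets[OF \<psi> bx] by simp
    moreover have "emeasure lborel (\<psi> -` box l u) < \<infinity>"
      by (subst em[symmetric]) (auto simp: emeasure_lborel_box_eq)
    ultimately show ?thesis by (auto simp: fmeasurable_def)
  qed
  note m = measurable_orthogonal_image[OF orth this] measure_orthogonal_image[OF orth this] this
  have "emeasure lborel ((\<lambda>z. w * z) -` box l u) = emeasure lborel (\<psi> -` ((\<lambda>z. w * z) -` box l u))"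
    by (rule em[OF pre])
  also have "\<dots> = emeasure lebesgue (\<psi> -` ((\<lambda>z. w * z) -` box l u))"
    using measurable_sets[OF \<psi> pre] by simp
  also have "\<dots> = emeasure lebesgue (T ` (\<psi> -` box l u))"
    by (simp only: rot)
  also have "\<dots> = emeasure lebesgue (\<psi> -` box l u)"
    using m by (simp add: emeasure_eq_measure2)
  also have "\<dots> = emeasure lborel (\<psi> -` box l u)"
    using measurable_sets[OF \<psi> bx] by simp
  also have "\<dots> = emeasure lborel (box l u)"
    by (rule em[symmetric]) simp
  also have "\<dots> = ennreal (\<Prod>b\<in>Basis. (u - l) \<bullet> b)"
    using lu by (rule emeasure_lborel_box)
  finally show "emeasure (distr lborel borel (\<lambda>z. w * z)) (box l u)
      = ennreal (\<Prod>b\<in>Basis. (u - l) \<bullet> b)"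
    by (simp add: emeasure_distr)
qed simp

text \<open>
  The sign in \<open>- (norm z)\<^sup>2\<close> makes the preimages of the rays \<open>{x<..}\<close> discs, which have finite
  measure; this is what \<open>measure_eqI_lessThan\<close> requires.
\<close>

lemma distr_lborel_neg_norm_square_complex:
  "distr lborel borel (\<lambda>z :: complex. - (norm z)\<^sup>2) =
   density lborel (\<lambda>t. ennreal pi * indicator {..0} t)"
proof (rule measure_eqI_lessThan)
  fix x :: real
  \<comment> \<open>The area of this disc is linear in \<open>x\<close>, which is why the image
    measure has the constant density \<open>pi\<close> on the negative axis.\<close>
  have "(\<lambda>z :: complex. - (norm z)\<^sup>2) -` {x<..} = (if x < 0 then ball 0 (sqrt (- x)) else {})"
  proof -
    have "x < - (norm z)\<^sup>2 \<longleftrightarrow> norm z < sqrt (- x)" if "x < 0" for z :: complex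
      using real_less_rsqrt[of "norm z" "- x"] real_sqrt_less_iff[of "(norm z)\<^sup>2" "- x"] by auto
    moreover have "\<not> x < - (norm z)\<^sup>2" if "\<not> x < 0" for z :: complex
      using that by (smt (verit) zero_le_power2)
    ultimately show ?thesis by auto
  qed
  then have 1: "emeasure (distr lborel borel (\<lambda>z :: complex. - (norm z)\<^sup>2)) {x<..}
      = ennreal (if x < 0 then pi * (- x) else 0)"
    by (simp add: emeasure_distr emeasure_ball unit_ball_vol_2)
  have "emeasure (density lborel (\<lambda>t. ennreal pi * indicator {..0} t)) {x<..}
      = (\<integral>\<^sup>+t. ennreal pi * indicator {x<..0} t \<partial>lborel)"
    by (subst emeasure_density) (auto intro!: nn_integral_cong split: split_indicator)
  also have "\<dots> = ennreal (if x < 0 then pi * (- x) else 0)"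
    by (simp add: nn_integral_cmult ennreal_mult'[symmetric])
  finally have 2: "emeasure (density lborel (\<lambda>t. ennreal pi * indicator {..0} t)) {x<..}
      = ennreal (if x < 0 then pi * (- x) else 0)" .
  show "emeasure (distr lborel borel (\<lambda>z :: complex. - (norm z)\<^sup>2)) {x<..} < \<infinity>"
    unfolding 1 by simp
  show "emeasure (distr lborel borel (\<lambda>z :: complex. - (norm z)\<^sup>2)) {x<..} =
     emeasure (density lborel (\<lambda>t. ennreal pi * indicator {..0} t)) {x<..}"
    unfolding 1 2 ..
qed auto

text \<open>The image measure under z -> -|z|^2 takes the place of polar coordinates and leaves
  \<open>pi\<close> times the Gamma integral of s^n exp(-\<alpha> s) over s > 0.\<close>

lemma nn_integral_norm_power_times_exp:
  assumes \<alpha>: "0 < \<alpha>"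
  shows "(\<integral>\<^sup>+z. ennreal ((norm (z :: complex)) ^ (2 * n) * exp (- \<alpha> * (norm z)\<^sup>2)) \<partial>lborel)
    = ennreal (pi * (fact n / \<alpha> ^ Suc n))"
proof -
  have "(\<integral>\<^sup>+z. ennreal ((norm (z :: complex)) ^ (2 * n) * exp (- \<alpha> * (norm z)\<^sup>2)) \<partial>lborel)
     = (\<integral>\<^sup>+t. ennreal ((- t) ^ n * exp (\<alpha> * t)) \<partial>distr lborel borel (\<lambda>z :: complex. - (norm z)\<^sup>2))"
    by (subst nn_integral_distr) (auto simp: power_mult)
  also have "\<dots> = (\<integral>\<^sup>+t. ennreal pi * (indicator {..0} t * ennreal ((- t) ^ n * exp (\<alpha> * t))) \<partial>lborel)"
    unfolding distr_lborel_neg_norm_square_complex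
    by (subst nn_integral_density) (auto simp: mult.assoc)
  also have "\<dots> = ennreal pi * (\<integral>\<^sup>+t. indicator {..0} t * ennreal ((- t) ^ n * exp (\<alpha> * t)) \<partial>lborel)"
    by (rule nn_integral_cmult) auto
  \<comment> \<open>Replacing \<open>t\<close> by \<open>- t / \<alpha>\<close> undoes the sign of
    the image measure and normalises the exponential; the factor \<open>1 / \<alpha>\<close> is the
    Jacobian.\<close>
  also have "(\<integral>\<^sup>+t. indicator {..0} t * ennreal ((- t) ^ n * exp (\<alpha> * t)) \<partial>lborel)
    = ennreal (1 / \<alpha>) * (\<integral>\<^sup>+t. indicator {..0} (- t / \<alpha>) * ennreal ((t / \<alpha>) ^ n * exp (- t)) \<partial>lborel)"
    using \<alpha> by (subst nn_integral_real_affine[where c = "- 1 / \<alpha>" and t = 0]) auto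
  also have "(\<integral>\<^sup>+t. indicator {..0} (- t / \<alpha>) * ennreal ((t / \<alpha>) ^ n * exp (- t)) \<partial>lborel)
    = (\<integral>\<^sup>+t. ennreal (1 / \<alpha> ^ n) * (ennreal (t ^ n * exp (- t)) * indicator {0..} t) \<partial>lborel)"
    using \<alpha> by (intro nn_integral_cong)
       (auto split: split_indicator simp: ennreal_mult'[symmetric] power_divide divide_simps)
  also have "\<dots> = ennreal (1 / \<alpha> ^ n) * ennreal (fact n)"
    by (subst nn_integral_cmult) (auto simp: nn_intergal_power_times_exp_Ici)
  finally show ?thesis
    using \<alpha> by (simp add: ennreal_mult[symmetric] field_simps)
qed

subsection \<open>Everywhere convergent power series\<close>

text \<open>Convergence at every point encodes an infinite radius of convergence. As a relation it
  lets the coefficients be handled as a plain sequence, without reference to iterated derivatives at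
  0.\<close>

definition entire_series :: "(nat \<Rightarrow> complex) \<Rightarrow> (complex \<Rightarrow> complex) \<Rightarrow> bool" where
  "entire_series a f \<longleftrightarrow> (\<forall>z. (\<lambda>n. a n * z ^ n) sums f z)"

lemma entire_series_sums: "entire_series a f \<Longrightarrow> (\<lambda>n. a n * z ^ n) sums f z"
  by (simp add: entire_series_def)

lemma entire_series_holomorphic:
  assumes "entire_series a f"
  shows "f holomorphic_on UNIV"
proof -
  have "f holomorphic_on ball 0 r" for r
    by (rule power_series_holomorphic[where a = a]) (simp add: entire_series_sums[OF assms])
  then show ?thesis
    by (simp add: holomorphic_on_def field_differentiable_at_within)
       (metis at_within_open centre_in_ball mem_ball_0 open_ball norm_ge_zero
          linordered_field_no_ub)
qed

lemma holomorphic_imp_entire_series: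
  assumes "f holomorphic_on UNIV"
  obtains a where "entire_series a f"
proof -
  have "entire_series (\<lambda>n. (deriv ^^ n) f 0 / fact n) f"
    unfolding entire_series_def
  proof
    fix z :: complex
    \<comment> \<open>Any radius above \<open>norm z\<close> serves, because the Taylor coefficients
      at 0 do not depend on the disc.\<close>
    have "f holomorphic_on ball 0 (norm z + 1)"
      using assms holomorphic_on_subset by blast
    from holomorphic_power_series[OF this, of z]
    show "(\<lambda>n. (deriv ^^ n) f 0 / fact n * z ^ n) sums f z" by simp
  qed
  then show ?thesis by (rule that)
qed

lemma entire_series_unique:
  assumes "entire_series a f" "entire_series a g"
  shows "f = g"
  using assms sums_unique2 unfolding entire_series_def by blast

lemma entire_series_add:
  assumes "entire_series a f" "entire_series b g"
  shows "entire_series (\<lambda>n. a n + b n) (\<lambda>z. f z + g z)"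
  using assms by (auto simp: entire_series_def distrib_right intro!: sums_add)

lemma entire_series_cmult:
  assumes "entire_series a f"
  shows "entire_series (\<lambda>n. c * a n) (\<lambda>z. c * f z)"
  using assms by (auto simp: entire_series_def mult.assoc intro!: sums_mult)

lemma entire_series_diff:
  assumes "entire_series a f" "entire_series b g"
  shows "entire_series (\<lambda>n. a n - b n) (\<lambda>z. f z - g z)"
  using assms by (auto simp: entire_series_def left_diff_distrib intro!: sums_diff)

lemma entire_series_polynomial:
  "entire_series (\<lambda>k. if k < n then b k else 0) (\<lambda>z. \<Sum>k<n. b k * z ^ k)"
  unfolding entire_series_def
proof
  fix z :: complex
  have "(\<lambda>k. (if k < n then b k else 0) * z ^ k) sums (\<Sum>k<n. (if k < n then b k else 0) * z ^ k)"
    by (rule sums_finite) auto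
  then show "(\<lambda>k. (if k < n then b k else 0) * z ^ k) sums (\<Sum>k<n. b k * z ^ k)"
    by simp
qed

lemma entire_series_monomial:
  "entire_series (\<lambda>n. if n = k then c else 0) (\<lambda>z. c * z ^ k)"
  unfolding entire_series_def
proof
  fix z :: complex
  have "(\<lambda>n. if n = k then c * z ^ n else 0) sums (c * z ^ k)"
    by (rule sums_single)
  then show "(\<lambda>n. (if n = k then c else 0) * z ^ n) sums (c * z ^ k)"
    by (rule sums_cong[THEN iffD1, rotated]) auto
qed

lemma entire_series_deriv:
  assumes "entire_series a f"
  shows "entire_series (\<lambda>n. of_nat (Suc n) * a (Suc n)) (deriv f)"
  unfolding entire_series_def
proof
  fix z :: complex
  have s: "summable (\<lambda>n. a n * y ^ n)" for y
    using entire_series_sums[OF assms] sums_summable by blast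
  have "f = (\<lambda>z. \<Sum>n. a n * z ^ n)"
    using entire_series_sums[OF assms] sums_unique by blast
  then have "(f has_field_derivative (\<Sum>n. diffs a n * z ^ n)) (at z)"
    using termdiffs_strong_converges_everywhere[OF s, of z] by simp
  then have "deriv f z = (\<Sum>n. diffs a n * z ^ n)"
    by (rule DERIV_imp_deriv)
  moreover have "summable (\<lambda>n. diffs a n * z ^ n)"
    by (rule termdiff_converges_all[OF s])
  ultimately show "(\<lambda>n. of_nat (Suc n) * a (Suc n) * z ^ n) sums deriv f z"
    by (simp add: diffs_def sums_iff)
qed

subsection \<open>Parseval identity for the Gaussian weight\<close>

text \<open>Cutting off to a disc makes every integrand of the Parseval argument integrable with no
  growth condition on the entire function.\<close>

lemma integrable_cball_indicator:
  fixes f :: "complex \<Rightarrow> 'b :: euclidean_space"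
  assumes "continuous_on UNIV f"
  shows "integrable lborel (\<lambda>z. indicator (cball 0 R) z *\<^sub>R f z)"
  by (rule borel_integrable_compact) (auto intro: continuous_on_subset[OF assms])

lemma monomials_orthogonal_cball:
  fixes \<alpha> R :: real
  assumes "j \<noteq> k"
  shows "(LINT z|lborel. indicator (cball 0 R) z *\<^sub>R
           (z ^ j * cnj z ^ k * complex_of_real (exp (- \<alpha> * (norm z)\<^sup>2)))) = 0"
    (is "integral\<^sup>L lborel ?F = 0")
proof -
  \<comment> \<open>Rotating by \<open>w\<close> with \<open>w ^ j * cnj w ^ k = -1\<close> negates the integrand.\<close>
  define t where "t = pi / (real j - real k)"
  define w where "w = cis t"
  have nw: "norm w = 1" by (simp add: w_def)
  have "w ^ j * cnj w ^ k = cis (real j * t - real k * t)"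
    unfolding w_def cis_cnj Complex.DeMoivre cis_mult by simp
  also have "real j * t - real k * t = pi"
    unfolding left_diff_distrib[symmetric] using assms by (simp add: t_def)
  finally have ww: "w ^ j * cnj w ^ k = -1" by simp
  have F: "?F (w * z) = - ?F z" for z
  proof -
    have "?F (w * z) = (w ^ j * cnj w ^ k) * ?F z"
      by (simp add: nw norm_mult power_mult_distrib scaleR_conv_of_real indicator_def)
    then show ?thesis by (simp add: ww)
  qed
  have meas: "?F \<in> borel_measurable lborel"
    by (intro borel_measurable_integrable integrable_cball_indicator continuous_intros)
  have "integral\<^sup>L lborel ?F = integral\<^sup>L (distr lborel borel (\<lambda>z. w * z)) ?F"
    by (simp only: distr_lborel_rotation_complex[OF nw])
  also have "\<dots> = integral\<^sup>L lborel (\<lambda>z. ?F (w * z))"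
    by (rule integral_distr) (use meas in simp_all)
  also have "\<dots> = - integral\<^sup>L lborel ?F"
    unfolding F by simp
  finally show ?thesis by simp
qed

text \<open>For a partial sum the square expands into a finite double sum, in which orthogonality
  leaves the diagonal. On the disc all partial sums are bounded by \<open>M\<close>, so dominated
  convergence passes to \<open>f\<close>.\<close>

lemma parseval_cball:
  fixes \<alpha> R :: real
  assumes ser: "entire_series a f" and R: "0 \<le> R"
  shows "(\<lambda>n. (norm (a n))\<^sup>2 * (LINT z|lborel. indicator (cball 0 R) (z :: complex) *\<^sub>R
            (norm z ^ (2 * n) * exp (- \<alpha> * (norm z)\<^sup>2))))
         sums (LINT z|lborel. indicator (cball 0 R) z *\<^sub>R ((norm (f z))\<^sup>2 * exp (- \<alpha> * (norm z)\<^sup>2)))"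
proof -
  define W :: "complex \<Rightarrow> complex" where "W = (\<lambda>z. complex_of_real (exp (- \<alpha> * (norm z)\<^sup>2)))"
  define P where "P = (\<lambda>N z. \<Sum>n<N. a n * z ^ n)"
  define M where "M = (\<Sum>n. norm (a n * complex_of_real R ^ n))"
  let ?B = "indicator (cball (0 :: complex) R) :: complex \<Rightarrow> real"
  let ?I = "\<lambda>j k. LINT z|lborel. ?B z *\<^sub>R (z ^ j * cnj z ^ k * W z)"
  have contW: "continuous_on UNIV W"
    unfolding W_def by (intro continuous_intros)
  have contf: "continuous_on UNIV f"
    using entire_series_holomorphic[OF ser] holomorphic_on_imp_continuous_on by blast
  \<comment> \<open>Convergence at \<open>R + 1\<close> gives absolute convergence at the strictly
    smaller radius \<open>R\<close>.\<close>
  have sumM: "summable (\<lambda>n. norm (a n * complex_of_real R ^ n))"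
    using powser_insidea[OF sums_summable[OF entire_series_sums[OF ser, of "of_real (R + 1)"]], of "of_real R"] R
    by (simp del: of_real_add)
  have Pbound: "norm (P N z) \<le> M" if "z \<in> cball 0 R" for N z
  proof -
    have "norm (P N z) \<le> (\<Sum>n<N. norm (a n * z ^ n))"
      unfolding P_def by (rule norm_sum)
    also have "\<dots> \<le> (\<Sum>n<N. norm (a n * complex_of_real R ^ n))"
      using that R by (intro sum_mono) (auto simp: norm_mult norm_power intro!: mult_left_mono power_mono)
    also have "\<dots> \<le> M"
      unfolding M_def using sumM by (intro sum_le_suminf) auto
    finally show ?thesis .
  qed
  have int: "integrable lborel (\<lambda>z. ?B z *\<^sub>R (z ^ j * cnj z ^ k * W z))" for j k
    by (intro integrable_cball_indicator continuous_intros contW)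
  have diag: "?I j j = complex_of_real (LINT z|lborel. ?B z *\<^sub>R
            (norm z ^ (2 * j) * exp (- \<alpha> * (norm z)\<^sup>2)))" for j
    by (subst integral_complex_of_real[symmetric], rule Bochner_Integration.integral_cong)
       (auto simp: W_def scaleR_conv_of_real power_mult power_mult_distrib[symmetric]
          complex_norm_square[symmetric] simp flip: of_real_power)
  have fin: "(LINT z|lborel. ?B z *\<^sub>R (P N z * cnj (P N z) * W z)) =
      (\<Sum>n<N. complex_of_real ((norm (a n))\<^sup>2 * (LINT z|lborel. ?B z *\<^sub>R
            (norm z ^ (2 * n) * exp (- \<alpha> * (norm z)\<^sup>2)))))" for N
  proof -
    have "(LINT z|lborel. ?B z *\<^sub>R (P N z * cnj (P N z) * W z)) =
       (LINT z|lborel. (\<Sum>j<N. \<Sum>k<N. (a j * cnj (a k)) * (?B z *\<^sub>R (z ^ j * cnj z ^ k * W z))))"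
      unfolding P_def cnj_sum sum_product
      unfolding sum_distrib_right scaleR_sum_right
      by (simp only: complex_cnj_mult complex_cnj_power scaleR_conv_of_real mult_ac)
    also have "\<dots> = (\<Sum>j<N. \<Sum>k<N. (a j * cnj (a k)) * ?I j k)"
      by (simp only: Bochner_Integration.integral_sum Bochner_Integration.integrable_sum int
            integrable_mult_right integral_mult_right_zero)
    also have "\<dots> = (\<Sum>j<N. \<Sum>k<N. if k = j then (a j * cnj (a k)) * ?I j k else 0)"
      using monomials_orthogonal_cball[of _ _ R \<alpha>] by (intro sum.cong) (auto simp: W_def)
    also have "\<dots> = (\<Sum>j<N. (a j * cnj (a j)) * ?I j j)"
      by simp
    finally show ?thesis
      unfolding diag by (simp only: complex_norm_square of_real_mult)
  qed
  have "(\<lambda>N. LINT z|lborel. ?B z *\<^sub>R (P N z * cnj (P N z) * W z)) \<longlonglongrightarrow>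
      (LINT z|lborel. ?B z *\<^sub>R (f z * cnj (f z) * W z))"
  proof (rule integral_dominated_convergence[where w = "\<lambda>z. ?B z *\<^sub>R (M * M * norm (W z))"])
    show "(\<lambda>z. ?B z *\<^sub>R (f z * cnj (f z) * W z)) \<in> borel_measurable lborel"
      by (intro borel_measurable_integrable integrable_cball_indicator continuous_intros contW contf)
    show "(\<lambda>z. ?B z *\<^sub>R (P N z * cnj (P N z) * W z)) \<in> borel_measurable lborel" for N
      unfolding P_def
      by (intro borel_measurable_integrable integrable_cball_indicator continuous_intros contW)
    show "integrable lborel (\<lambda>z. ?B z *\<^sub>R (M * M * norm (W z)))"
      by (intro integrable_cball_indicator continuous_intros contW)
    show "AE z in lborel. (\<lambda>N. ?B z *\<^sub>R (P N z * cnj (P N z) * W z)) \<longlonglongrightarrow> ?B z *\<^sub>R (f z * cnj (f z) * W z)"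
    proof (rule AE_I2)
      fix z
      have "(\<lambda>N. P N z) \<longlonglongrightarrow> f z"
        using entire_series_sums[OF ser, of z] by (simp add: sums_def P_def)
      then show "(\<lambda>N. ?B z *\<^sub>R (P N z * cnj (P N z) * W z)) \<longlonglongrightarrow> ?B z *\<^sub>R (f z * cnj (f z) * W z)"
        by (intro tendsto_intros)
    qed
    show "AE z in lborel. norm (?B z *\<^sub>R (P N z * cnj (P N z) * W z)) \<le> ?B z *\<^sub>R (M * M * norm (W z))" for N
    proof (rule AE_I2)
      fix z
      show "norm (?B z *\<^sub>R (P N z * cnj (P N z) * W z)) \<le> ?B z *\<^sub>R (M * M * norm (W z))"
      proof (cases "z \<in> cball 0 R")
        case True
        have "norm (P N z) * norm (P N z) \<le> M * M"
          using Pbound[OF True] by (intro mult_mono) (auto intro: order_trans[OF norm_ge_zero])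
        then show ?thesis using True by (auto simp: norm_mult intro!: mult_right_mono)
      qed simp
    qed
  qed
  also have "(LINT z|lborel. ?B z *\<^sub>R (f z * cnj (f z) * W z)) =
      complex_of_real (LINT z|lborel. ?B z *\<^sub>R ((norm (f z))\<^sup>2 * exp (- \<alpha> * (norm z)\<^sup>2)))"
    by (subst integral_complex_of_real[symmetric], rule Bochner_Integration.integral_cong)
       (auto simp: W_def scaleR_conv_of_real complex_norm_square[symmetric] simp flip: of_real_power)
  finally have "(\<lambda>N. complex_of_real (\<Sum>n<N. (norm (a n))\<^sup>2 * (LINT z|lborel. ?B z *\<^sub>R
            (norm z ^ (2 * n) * exp (- \<alpha> * (norm z)\<^sup>2))))) \<longlonglongrightarrow>
      complex_of_real (LINT z|lborel. ?B z *\<^sub>R ((norm (f z))\<^sup>2 * exp (- \<alpha> * (norm z)\<^sup>2)))"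
    unfolding fin of_real_sum .
  then show ?thesis
    unfolding sums_def by (simp only: tendsto_of_real_iff)
qed

text \<open>Working in \<open>ennreal\<close> is essential: the finiteness of either side will later
  decide whether \<open>f\<close> lies in the Fock space, so it must not be assumed here.\<close>

lemma parseval_nn_integral:
  fixes \<alpha> :: real
  assumes ser: "entire_series a f" and \<alpha>: "0 < \<alpha>"
  shows "(\<integral>\<^sup>+z. ennreal ((norm (f z))\<^sup>2 * exp (- \<alpha> * (norm z)\<^sup>2)) \<partial>lborel)
    = (\<Sum>n. ennreal ((norm (a n))\<^sup>2 * (pi * (fact n / \<alpha> ^ Suc n))))"
proof -
  have contf: "continuous_on UNIV f"
    using entire_series_holomorphic[OF ser] holomorphic_on_imp_continuous_on by blast
  have [measurable]: "f \<in> borel_measurable borel"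
    by (rule borel_measurable_continuous_onI[OF contf])
  define u where "u = (\<lambda>z. ennreal ((norm (f z))\<^sup>2 * exp (- \<alpha> * (norm z)\<^sup>2)))"
  define v where "v = (\<lambda>n (z::complex). ennreal ((norm (a n))\<^sup>2 * (norm z ^ (2 * n) * exp (- \<alpha> * (norm z)\<^sup>2))))"
  define B where "B = (\<lambda>m z. indicator (cball (0 :: complex) (real m)) z :: ennreal)"
  have [measurable]: "u \<in> borel_measurable borel" "v n \<in> borel_measurable borel" 
    for n by (auto simp: u_def v_def)
  have [measurable]: "B m \<in> borel_measurable borel" for m
    unfolding B_def by (rule borel_measurable_indicator) simp
  \<comment> \<open>\<open>u\<close> and the series of the \<open>v n\<close> generally differ
    pointwise; the cross terms disappear only after integration over a full disc.\<close>
  have ball: "(\<integral>\<^sup>+z. u z * B m z \<partial>lborel) = (\<integral>\<^sup>+z. (\<Sum>n. v n z) * B m z \<partial>lborel)" for m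
  proof -
    let ?C = "\<lambda>z. indicator (cball 0 (real m)) (z::complex) :: real"
    let ?J = "\<lambda>n. (norm (a n))\<^sup>2 * (LINT z|lborel. ?C (z :: complex) *\<^sub>R
            (norm z ^ (2 * n) * exp (- \<alpha> * (norm z)\<^sup>2)))"
    have J: "ennreal (?J n) = (\<integral>\<^sup>+z. v n z * B m z \<partial>lborel)" for n
    proof -
      have "ennreal (?J n) = ennreal ((norm (a n))\<^sup>2) * (\<integral>\<^sup>+z. ennreal (?C z *\<^sub>R
            (norm z ^ (2 * n) * exp (- \<alpha> * (norm z)\<^sup>2))) \<partial>lborel)"
        by (subst nn_integral_eq_integral[OF integrable_cball_indicator])
           (auto intro!: continuous_intros simp: ennreal_mult')
      also have "\<dots> = (\<integral>\<^sup>+z. ennreal ((norm (a n))\<^sup>2) * ennreal (?C z *\<^sub>R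
            (norm z ^ (2 * n) * exp (- \<alpha> * (norm z)\<^sup>2))) \<partial>lborel)"
        by (rule nn_integral_cmult[symmetric])
           (intro measurable_compose[OF _ measurable_ennreal] borel_measurable_integrable
              integrable_cball_indicator continuous_intros)
      also have "\<dots> = (\<integral>\<^sup>+z. v n z * B m z \<partial>lborel)"
        by (intro nn_integral_cong) (auto simp: v_def B_def ennreal_mult' split: split_indicator)
      finally show ?thesis .
    qed
    have "(\<integral>\<^sup>+z. u z * B m z \<partial>lborel) =
        (\<integral>\<^sup>+z. ennreal (?C z *\<^sub>R ((norm (f z))\<^sup>2 * exp (- \<alpha> * (norm z)\<^sup>2))) \<partial>lborel)"
      by (intro nn_integral_cong) (auto simp: u_def B_def split: split_indicator)
    also have "\<dots> = ennreal (LINT z|lborel. ?C z *\<^sub>R ((norm (f z))\<^sup>2 * exp (- \<alpha> * (norm z)\<^sup>2)))"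
      by (intro nn_integral_eq_integral integrable_cball_indicator continuous_intros contf) auto
    also have "\<dots> = ennreal (suminf ?J)"
      using parseval_cball[OF ser, of "real m" \<alpha>] by (simp add: sums_iff)
    also have "\<dots> = (\<Sum>n. ennreal (?J n))"
      using parseval_cball[OF ser, of "real m" \<alpha>]
      by (intro suminf_ennreal2[symmetric]) (auto simp: sums_iff intro!: integral_nonneg_AE)
    also have "\<dots> = (\<Sum>n. \<integral>\<^sup>+z. v n z * B m z \<partial>lborel)"
      by (simp only: J)
    also have "\<dots> = (\<integral>\<^sup>+z. (\<Sum>n. v n z * B m z) \<partial>lborel)"
      by (subst nn_integral_suminf) auto
    finally show ?thesis by simp
  qed
  \<comment> \<open>Discs of integer radius exhaust the plane. The claim is made for general
    \<open>g\<close> because it is applied both to \<open>u\<close> and to the series of the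
    \<open>v n\<close>.\<close>
  have lim: "(\<lambda>m. \<integral>\<^sup>+z. g z * B m z \<partial>lborel) \<longlonglongrightarrow> (\<integral>\<^sup>+z. g z \<partial>lborel)"
    if [measurable]: "g \<in> borel_measurable borel" for g :: "complex \<Rightarrow> ennreal"
  proof (rule nn_integral_LIMSEQ)
    show "incseq (\<lambda>m z. g z * B m z)"
      by (auto simp: incseq_def le_fun_def B_def split: split_indicator)
    show "(\<lambda>m. g z * B m z) \<longlonglongrightarrow> g z" for z
    proof (rule tendsto_eventually)
      have "\<forall>m\<ge>nat \<lceil>norm z\<rceil>. g z * B m z = g z"
        by (auto simp: B_def indicator_def nat_ceiling_le_eq)
      then show "\<forall>\<^sub>F m in sequentially. g z * B m z = g z"
        unfolding eventually_sequentially by (rule exI)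
    qed
  qed auto
  have V: "(\<integral>\<^sup>+z. v n z \<partial>lborel) = ennreal ((norm (a n))\<^sup>2 * (pi * (fact n / \<alpha> ^ Suc n)))" for n
  proof -
    have "(\<integral>\<^sup>+z. v n z \<partial>lborel) = ennreal ((norm (a n))\<^sup>2) *
        (\<integral>\<^sup>+z. ennreal (norm (z :: complex) ^ (2 * n) * exp (- \<alpha> * (norm z)\<^sup>2)) \<partial>lborel)"
      unfolding v_def ennreal_mult'[OF zero_le_power2] by (rule nn_integral_cmult) simp
    then show ?thesis
      unfolding nn_integral_norm_power_times_exp[OF \<alpha>] ennreal_mult'[OF zero_le_power2] .
  qed
  have "(\<integral>\<^sup>+z. u z \<partial>lborel) = (\<integral>\<^sup>+z. (\<Sum>n. v n z) \<partial>lborel)"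
    using lim[of u] lim[of "\<lambda>z. \<Sum>n. v n z"] unfolding ball by (auto intro: LIMSEQ_unique)
  also have "\<dots> = (\<Sum>n. \<integral>\<^sup>+z. v n z \<partial>lborel)"
    by (rule nn_integral_suminf) measurable
  also have "\<dots> = (\<Sum>n. ennreal ((norm (a n))\<^sup>2 * (pi * (fact n / \<alpha> ^ Suc n))))"
    by (simp only: V)
  finally show ?thesis by (simp add: u_def)
qed

subsection \<open>Fock spaces in terms of Taylor coefficients\<close>

lemma fock_coeff_square: "0 < \<alpha> \<Longrightarrow> (fock_coeff \<alpha> n)\<^sup>2 = fact n / \<alpha> ^ n"
  by (simp add: fock_coeff_def)

lemma fock_coeff_pos: "0 < \<alpha> \<Longrightarrow> 0 < fock_coeff \<alpha> n"
  by (simp add: fock_coeff_def)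

text \<open>The moment pi n! / \<alpha>^(n+1) is pi / \<alpha> times
  \<open>(fock_coeff \<alpha> n)\<^sup>2\<close>, and the normalisation \<open>\<alpha> / pi\<close>
  of the inner product cancels the prefactor. Thus the Fock space becomes a weighted l^2 space of
  Taylor coefficients.\<close>

lemma
  assumes ser: "entire_series a f" and \<alpha>: "0 < \<alpha>"
  shows fock_space_iff_summable: "f \<in> fock_space \<alpha> \<longleftrightarrow> summable (\<lambda>n. (norm (a n))\<^sup>2 * (fock_coeff \<alpha> n)\<^sup>2)"
    and fock_integral_sums: "f \<in> fock_space \<alpha> \<Longrightarrow> (\<lambda>n. (norm (a n))\<^sup>2 * (fock_coeff \<alpha> n)\<^sup>2) sums
      (\<alpha> / pi * (LINT z|lborel. (norm (f z))\<^sup>2 * exp (- \<alpha> * (norm z)\<^sup>2)))"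
proof -
  let ?F = "\<lambda>z. (norm (f z))\<^sup>2 * exp (- \<alpha> * (norm z)\<^sup>2)"
  let ?A = "\<lambda>n. (norm (a n))\<^sup>2 * (fock_coeff \<alpha> n)\<^sup>2"
  have hol: "f holomorphic_on UNIV" by (rule entire_series_holomorphic[OF ser])
  have [measurable]: "f \<in> borel_measurable borel"
    by (rule borel_measurable_continuous_onI[OF holomorphic_on_imp_continuous_on[OF hol]])
  have nn: "(\<integral>\<^sup>+z. ennreal (?F z) \<partial>lborel) = (\<Sum>n. ennreal (pi / \<alpha> * ?A n))"
    unfolding parseval_nn_integral[OF ser \<alpha>] using \<alpha>
    by (simp add: fock_coeff_square field_simps)
  have mem: "f \<in> fock_space \<alpha> \<longleftrightarrow> (\<Sum>n. ennreal (pi / \<alpha> * ?A n)) < \<infinity>"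
    unfolding nn[symmetric] by (simp add: fock_space_def hol integrable_iff_bounded)
  show iff: "f \<in> fock_space \<alpha> \<longleftrightarrow> summable ?A"
  proof
    assume "f \<in> fock_space \<alpha>"
    then have "summable (\<lambda>n. pi / \<alpha> * ?A n)"
      using \<alpha> unfolding mem by (intro summable_suminf_not_top) (auto simp: less_top)
    then show "summable ?A" using \<alpha> by (subst (asm) summable_cmult_iff) auto
  next
    assume "summable ?A"
    then have "summable (\<lambda>n. pi / \<alpha> * ?A n)" by (rule summable_mult)
    then show "f \<in> fock_space \<alpha>"
      using \<alpha> unfolding mem by (subst suminf_ennreal2) auto
  qed
  assume "f \<in> fock_space \<alpha>"
  then have sm: "summable ?A" and int: "integrable lborel ?F"
    using iff by (auto simp: fock_space_def)
  have "ennreal (LINT z|lborel. ?F z) = (\<Sum>n. ennreal (pi / \<alpha> * ?A n))"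
    unfolding nn[symmetric] by (rule nn_integral_eq_integral[OF int, symmetric]) simp
  also have "\<dots> = ennreal (\<Sum>n. pi / \<alpha> * ?A n)"
    using \<alpha> sm by (intro suminf_ennreal2 summable_mult) auto
  finally have "ennreal (LINT z|lborel. ?F z) = ennreal (pi / \<alpha> * suminf ?A)"
    unfolding suminf_mult[OF sm] .
  moreover have "0 \<le> pi / \<alpha> * suminf ?A"
    using \<alpha> sm by (intro mult_nonneg_nonneg suminf_nonneg) auto
  ultimately have "(LINT z|lborel. ?F z) = pi / \<alpha> * suminf ?A"
    by (subst (asm) ennreal_inj) auto
  then show "?A sums (\<alpha> / pi * (LINT z|lborel. ?F z))"
    using sm \<alpha> by (simp add: sums_iff)
qed

lemma fock_space_entire_series:
  assumes "f \<in> fock_space \<alpha>"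
  obtains a where "entire_series a f"
  using assms holomorphic_imp_entire_series by (auto simp: fock_space_def)

lemma fock_space_add:
  assumes "0 < \<alpha>" "f \<in> fock_space \<alpha>" "g \<in> fock_space \<alpha>"
  shows "(\<lambda>z. f z + g z) \<in> fock_space \<alpha>"
proof -
  obtain a b where ser: "entire_series a f" "entire_series b g"
    using assms fock_space_entire_series by metis
  let ?c = "\<lambda>n. (fock_coeff \<alpha> n)\<^sup>2"
  have sum: "summable (\<lambda>n. 2 * ((norm (a n))\<^sup>2 * ?c n) + 2 * ((norm (b n))\<^sup>2 * ?c n))"
    using fock_space_iff_summable ser assms by (intro summable_add summable_mult) auto
  have "norm ((norm (a n + b n))\<^sup>2 * ?c n) \<le> 2 * ((norm (a n))\<^sup>2 * ?c n) + 2 * ((norm (b n))\<^sup>2 * ?c n)" for n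
  proof -
    have "(norm (a n + b n))\<^sup>2 \<le> (norm (a n) + norm (b n))\<^sup>2"
      by (intro power_mono norm_triangle_ineq) auto
    also have "\<dots> \<le> 2 * (norm (a n))\<^sup>2 + 2 * (norm (b n))\<^sup>2"
      using sum_squares_bound[of "norm (a n)" "norm (b n)"] by (simp add: power2_sum)
    finally have "(norm (a n + b n))\<^sup>2 * ?c n \<le> (2 * (norm (a n))\<^sup>2 + 2 * (norm (b n))\<^sup>2) * ?c n"
      by (intro mult_right_mono) auto
    then show ?thesis by (simp add: algebra_simps)
  qed
  then have "summable (\<lambda>n. (norm (a n + b n))\<^sup>2 * ?c n)"
    by (rule summable_comparison_test'[OF sum])
  then show ?thesis
    using fock_space_iff_summable[OF entire_series_add[OF ser]] assms by simp
qed

lemma fock_space_cmult: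
  assumes "f \<in> fock_space \<alpha>"
  shows "(\<lambda>z. c * f z) \<in> fock_space \<alpha>"
  using assms by (auto simp: fock_space_def norm_mult power_mult_distrib mult.assoc intro!: holomorphic_intros)

text \<open>Polarization: the norm identity holds for every combination \<open>f + u * g\<close>
  with u = 1, -1, i, -i, and the same linear combination of the four identities gives the mixed one,
  for the integral and for the series alike.\<close>

lemma fock_inner_sums:
  assumes \<alpha>: "0 < \<alpha>" and f: "f \<in> fock_space \<alpha>" and g: "g \<in> fock_space \<alpha>"
    and ser: "entire_series a f" "entire_series b g"
  shows "(\<lambda>n. a n * cnj (b n) * complex_of_real ((fock_coeff \<alpha> n)\<^sup>2)) sums fock_inner \<alpha> f g"
proof -
  define Q where "Q = (\<lambda>h :: complex \<Rightarrow> complex. LINT z|lborel. (norm (h z))\<^sup>2 * exp (- \<alpha> * (norm z)\<^sup>2))"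
  define h where "h = (\<lambda>u :: complex. \<lambda>z. f z + u * g z)"
  let ?c = "complex_of_real (\<alpha> / pi)"
  \<comment> \<open>The weight \<open>w\<close> stays arbitrary because the identity is used with
    the Gaussian under the integral and with the squared coefficient in the series. The factors
    \<open>1\<close> and \<open>-1\<close> are written out so that each term is an instance of
    \<open>h u\<close>.\<close>
  have polar: "x * cnj y * complex_of_real w = (complex_of_real ((norm (x + 1 * y))\<^sup>2 * w)
      - complex_of_real ((norm (x + (-1) * y))\<^sup>2 * w) + \<i> * complex_of_real ((norm (x + \<i> * y))\<^sup>2 * w)
      - \<i> * complex_of_real ((norm (x + (-\<i>) * y))\<^sup>2 * w)) / 4" for x y w
    unfolding of_real_mult complex_norm_square by (simp add: algebra_simps)
  have hs: "h u \<in> fock_space \<alpha>" "entire_series (\<lambda>n. a n + u * b n) (h u)" for u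
    unfolding h_def using \<alpha> f g ser
    by (auto intro: fock_space_add fock_space_cmult entire_series_add entire_series_cmult)
  have int: "integrable lborel (\<lambda>z. complex_of_real ((norm (h u z))\<^sup>2 * exp (- \<alpha> * (norm z)\<^sup>2)))" for u
    using hs(1)[of u] unfolding fock_space_def by (intro integrable_of_real) auto
  have Q: "(\<lambda>n. complex_of_real ((norm (a n + u * b n))\<^sup>2 * (fock_coeff \<alpha> n)\<^sup>2))
      sums (?c * complex_of_real (Q (h u)))" for u
    using sums_of_real[OF fock_integral_sums[OF hs(2) \<alpha> hs(1)], where 'a = complex] unfolding Q_def by (simp only: of_real_mult)
  have "(LINT z|lborel. f z * cnj (g z) * complex_of_real (exp (- \<alpha> * (norm z)\<^sup>2))) =
     (LINT z|lborel. (complex_of_real ((norm (h 1 z))\<^sup>2 * exp (- \<alpha> * (norm z)\<^sup>2))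
        - complex_of_real ((norm (h (-1) z))\<^sup>2 * exp (- \<alpha> * (norm z)\<^sup>2))
        + \<i> * complex_of_real ((norm (h \<i> z))\<^sup>2 * exp (- \<alpha> * (norm z)\<^sup>2))
        - \<i> * complex_of_real ((norm (h (-\<i>) z))\<^sup>2 * exp (- \<alpha> * (norm z)\<^sup>2))) / 4)"
    unfolding polar[of "f _"] h_def ..
  also have "\<dots> = (complex_of_real (Q (h 1)) - complex_of_real (Q (h (-1)))
      + \<i> * complex_of_real (Q (h \<i>)) - \<i> * complex_of_real (Q (h (-\<i>)))) / 4"
    unfolding Q_def integral_complex_of_real[symmetric]
    by (simp only: integral_divide_zero Bochner_Integration.integral_diff Bochner_Integration.integral_add
          Bochner_Integration.integrable_diff Bochner_Integration.integrable_add int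
          integrable_mult_right integral_mult_right_zero)
  finally have I: "(LINT z|lborel. f z * cnj (g z) * complex_of_real (exp (- \<alpha> * (norm z)\<^sup>2))) =
     (complex_of_real (Q (h 1)) - complex_of_real (Q (h (-1)))
      + \<i> * complex_of_real (Q (h \<i>)) - \<i> * complex_of_real (Q (h (-\<i>)))) / 4" .
  have dist: "c * ((A - B + \<i> * C - \<i> * D) / 4) = (c * A - c * B + \<i> * (c * C) - \<i> * (c * D)) / 4"
    for c A B C D :: complex
    by (simp add: field_simps)
  have inner: "fock_inner \<alpha> f g = (?c * complex_of_real (Q (h 1)) - ?c * complex_of_real (Q (h (-1)))
      + \<i> * (?c * complex_of_real (Q (h \<i>))) - \<i> * (?c * complex_of_real (Q (h (-\<i>))))) / 4"
    unfolding fock_inner_def I by (rule dist)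
  have "(\<lambda>n. (complex_of_real ((norm (a n + 1 * b n))\<^sup>2 * (fock_coeff \<alpha> n)\<^sup>2)
        - complex_of_real ((norm (a n + (-1) * b n))\<^sup>2 * (fock_coeff \<alpha> n)\<^sup>2)
        + \<i> * complex_of_real ((norm (a n + \<i> * b n))\<^sup>2 * (fock_coeff \<alpha> n)\<^sup>2)
        - \<i> * complex_of_real ((norm (a n + (-\<i>) * b n))\<^sup>2 * (fock_coeff \<alpha> n)\<^sup>2)) / 4) sums fock_inner \<alpha> f g"
    unfolding inner
    by (rule sums_divide[OF sums_diff[OF sums_add[OF sums_diff[OF Q Q] sums_mult[OF Q]] sums_mult[OF Q]]])
  also have "(\<lambda>n. (complex_of_real ((norm (a n + 1 * b n))\<^sup>2 * (fock_coeff \<alpha> n)\<^sup>2)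
        - complex_of_real ((norm (a n + (-1) * b n))\<^sup>2 * (fock_coeff \<alpha> n)\<^sup>2)
        + \<i> * complex_of_real ((norm (a n + \<i> * b n))\<^sup>2 * (fock_coeff \<alpha> n)\<^sup>2)
        - \<i> * complex_of_real ((norm (a n + (-\<i>) * b n))\<^sup>2 * (fock_coeff \<alpha> n)\<^sup>2)) / 4)
      = (\<lambda>n. a n * cnj (b n) * complex_of_real ((fock_coeff \<alpha> n)\<^sup>2))"
    unfolding polar[of "a _"] ..
  finally show ?thesis .
qed

lemma
  assumes \<alpha>: "0 < \<alpha>" and f: "f \<in> fock_space \<alpha>" and ser: "entire_series a f"
  shows fock_norm_square_sums: "(\<lambda>n. (norm (a n))\<^sup>2 * (fock_coeff \<alpha> n)\<^sup>2) sums (fock_norm \<alpha> f)\<^sup>2"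
    and fock_norm_nonneg: "0 \<le> fock_norm \<alpha> f"
proof -
  have e: "Re (a n * cnj (a n) * complex_of_real ((fock_coeff \<alpha> n)\<^sup>2))
      = (norm (a n))\<^sup>2 * (fock_coeff \<alpha> n)\<^sup>2" for n
    unfolding complex_norm_square[symmetric] of_real_mult[symmetric] by (rule Re_complex_of_real)
  have s: "(\<lambda>n. (norm (a n))\<^sup>2 * (fock_coeff \<alpha> n)\<^sup>2) sums Re (fock_inner \<alpha> f f)"
    using sums_Re[OF fock_inner_sums[OF \<alpha> f f ser ser]] unfolding e .
  \<comment> \<open>This lets squaring undo the square root in \<open>fock_norm\<close>.\<close>
  have "0 \<le> Re (fock_inner \<alpha> f f)"
    by (rule sums_le[OF _ sums_zero s]) simp
  with s show "(\<lambda>n. (norm (a n))\<^sup>2 * (fock_coeff \<alpha> n)\<^sup>2) sums (fock_norm \<alpha> f)\<^sup>2"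
    and "0 \<le> fock_norm \<alpha> f"
    by (simp_all add: fock_norm_def)
qed

section \<open>Monomials, truncated Taylor series and convergence in norm\<close>

lemma fock_space_monomial:
  assumes "0 < \<alpha>"
  shows "(\<lambda>z. c * z ^ k) \<in> fock_space \<alpha>"
proof -
  have "summable (\<lambda>n. (norm (if n = k then c else 0))\<^sup>2 * (fock_coeff \<alpha> n)\<^sup>2)"
    by (rule summable_finite[of "{k}"]) auto
  then show ?thesis using fock_space_iff_summable[OF entire_series_monomial assms] by simp
qed

text \<open>Pairing with a monomial isolates one Taylor coefficient; orthonormality and the
  uniqueness of the adjoint both rest on this.\<close>

lemma fock_inner_monomial:
  assumes "0 < \<alpha>" "h \<in> fock_space \<alpha>" "entire_series b h"
  shows "fock_inner \<alpha> (\<lambda>z. c * z ^ k) h = c * cnj (b k) * complex_of_real ((fock_coeff \<alpha> k)\<^sup>2)"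
proof -
  note s = fock_inner_sums[OF assms(1) fock_space_monomial[OF assms(1)] assms(2) entire_series_monomial assms(3), of k c]
  have "(\<lambda>n. if n = k then c * cnj (b n) * complex_of_real ((fock_coeff \<alpha> n)\<^sup>2) else 0) sums
      (c * cnj (b k) * complex_of_real ((fock_coeff \<alpha> k)\<^sup>2))"
    by (rule sums_single)
  moreover have "(\<lambda>n. if n = k then c * cnj (b n) * complex_of_real ((fock_coeff \<alpha> n)\<^sup>2) else 0)
     = (\<lambda>n. (if n = k then c else 0) * cnj (b n) * complex_of_real ((fock_coeff \<alpha> n)\<^sup>2))"
    by auto
  ultimately show ?thesis using sums_unique2[OF s] by simp
qed

text \<open>Only finitely many coefficients change, so summability persists. The sequence
  \<open>b\<close> is arbitrary, since below it also stands for an expansion not yet known to be the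
  Taylor series of \<open>f\<close>.\<close>

lemma fock_space_polynomial_diff:
  assumes "0 < \<alpha>" "f \<in> fock_space \<alpha>" "entire_series a f"
  shows "(\<lambda>z. f z - (\<Sum>k<n. b k * z ^ k)) \<in> fock_space \<alpha>"
    and "entire_series (\<lambda>k. a k - (if k < n then b k else 0)) (\<lambda>z. f z - (\<Sum>k<n. b k * z ^ k))"
proof -
  show ser: "entire_series (\<lambda>k. a k - (if k < n then b k else 0)) (\<lambda>z. f z - (\<Sum>k<n. b k * z ^ k))"
    by (rule entire_series_diff[OF assms(3) entire_series_polynomial])
  have sum: "summable (\<lambda>k. (norm (a k))\<^sup>2 * (fock_coeff \<alpha> k)\<^sup>2)"
    using fock_space_iff_summable assms by blast
  have "summable (\<lambda>k. (norm (a k - (if k < n then b k else 0)))\<^sup>2 * (fock_coeff \<alpha> k)\<^sup>2)"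
    by (rule iffD2[OF summable_cong sum]) (auto simp: eventually_sequentially intro!: exI[of _ n])
  then show "(\<lambda>z. f z - (\<Sum>k<n. b k * z ^ k)) \<in> fock_space \<alpha>"
    using fock_space_iff_summable[OF ser assms(1)] by simp
qed

text \<open>The squared norm of the remainder is the tail of the convergent series for the squared
  norm of \<open>f\<close>.\<close>

lemma fock_sums_power_series:
  assumes \<alpha>: "0 < \<alpha>" and f: "f \<in> fock_space \<alpha>" and ser: "entire_series a f"
  shows "fock_sums \<alpha> (\<lambda>k z. a k * z ^ k) f"
proof -
  let ?A = "\<lambda>n. (norm (a n))\<^sup>2 * (fock_coeff \<alpha> n)\<^sup>2"
  let ?r = "\<lambda>n z. f z - (\<Sum>k<n. a k * z ^ k)"
  note A = fock_norm_square_sums[OF \<alpha> f ser]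
  have tail: "(fock_norm \<alpha> (?r n))\<^sup>2 = (fock_norm \<alpha> f)\<^sup>2 - (\<Sum>k<n. ?A k)" for n
  proof -
    have s: "(\<lambda>k. (norm (a k - (if k < n then a k else 0)))\<^sup>2 * (fock_coeff \<alpha> k)\<^sup>2) sums (fock_norm \<alpha> (?r n))\<^sup>2"
      by (rule fock_norm_square_sums[OF \<alpha> fock_space_polynomial_diff[OF \<alpha> f ser]])
    have "(\<lambda>k. ?A k - (if k < n then ?A k else 0)) sums
        ((fock_norm \<alpha> f)\<^sup>2 - (\<Sum>k<n. ?A k))"
    proof -
      have "(\<lambda>k. if k < n then ?A k else 0) sums (\<Sum>k<n. if k < n then ?A k else 0)"
        by (rule sums_finite) auto
      then show ?thesis by (intro sums_diff[OF A]) simp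
    qed
    moreover have "(\<lambda>k. ?A k - (if k < n then ?A k else 0)) =
      (\<lambda>k. (norm (a k - (if k < n then a k else 0)))\<^sup>2 * (fock_coeff \<alpha> k)\<^sup>2)" by auto
    ultimately show ?thesis using sums_unique2[OF s] by simp
  qed
  have "(\<lambda>n. (fock_norm \<alpha> f)\<^sup>2 - (\<Sum>k<n. ?A k)) \<longlonglongrightarrow> (fock_norm \<alpha> f)\<^sup>2 - (fock_norm \<alpha> f)\<^sup>2"
    using A unfolding sums_def by (intro tendsto_intros)
  then have "(\<lambda>n. (fock_norm \<alpha> (?r n))\<^sup>2) \<longlonglongrightarrow> 0"
    unfolding tail by simp
  then have "(\<lambda>n. sqrt ((fock_norm \<alpha> (?r n))\<^sup>2)) \<longlonglongrightarrow> sqrt 0"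
    by (rule tendsto_real_sqrt)
  then have "(\<lambda>n. fock_norm \<alpha> (?r n)) \<longlonglongrightarrow> 0"
    by (simp add: tendsto_rabs_zero_iff)
  then show ?thesis
    using f fock_space_monomial[OF \<alpha>] by (simp add: fock_sums_def)
qed

text \<open>Once \<open>n\<close> exceeds \<open>k\<close>, the \<open>k\<close>-th coefficient of
  the remainder is frozen at \<open>a k - b k\<close>; its weighted square is at most the squared
  norm of the remainder, which tends to 0.\<close>

lemma fock_sums_coefficients:
  assumes \<alpha>: "0 < \<alpha>" and ser: "entire_series a f" and sums: "fock_sums \<alpha> (\<lambda>k z. b k * z ^ k) f"
  shows "b = a"
proof
  fix k
  let ?r = "\<lambda>n z. f z - (\<Sum>k<n. b k * z ^ k)"
  have f: "f \<in> fock_space \<alpha>" and lim: "(\<lambda>n. fock_norm \<alpha> (?r n)) \<longlonglongrightarrow> 0"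
    using sums by (auto simp: fock_sums_def)
  have "(norm (a k - b k))\<^sup>2 * (fock_coeff \<alpha> k)\<^sup>2 \<le> (fock_norm \<alpha> (?r n))\<^sup>2" if "k < n" for n
  proof -
    note s = fock_norm_square_sums[OF \<alpha> fock_space_polynomial_diff[OF \<alpha> f ser], of n b]
    have "(\<Sum>i\<in>{k}. (norm (a i - (if i < n then b i else 0)))\<^sup>2 * (fock_coeff \<alpha> i)\<^sup>2) \<le> (fock_norm \<alpha> (?r n))\<^sup>2"
      unfolding sums_unique[OF s] by (rule sum_le_suminf) (use s in \<open>auto simp: sums_iff\<close>)
    then show ?thesis using that by simp
  qed
  moreover have "(\<lambda>n. (fock_norm \<alpha> (?r n))\<^sup>2) \<longlonglongrightarrow> 0\<^sup>2"
    by (intro tendsto_intros lim)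
  ultimately have "(norm (a k - b k))\<^sup>2 * (fock_coeff \<alpha> k)\<^sup>2 \<le> 0"
    by (intro tendsto_lowerbound[where F = sequentially and f = "\<lambda>n. (fock_norm \<alpha> (?r n))\<^sup>2"])
       (auto simp: eventually_sequentially intro!: exI[of _ "Suc k"])
  then have "(norm (a k - b k))\<^sup>2 \<le> 0"
    using fock_coeff_pos[OF \<alpha>, of k] by (simp add: mult_le_0_iff)
  then show "b k = a k" by simp
qed

lemma fock_basis_eq: "fock_basis \<alpha> k = (\<lambda>z. (1 / complex_of_real (fock_coeff \<alpha> k)) * z ^ k)"
  by (auto simp: fock_basis_def)

lemma fock_orthonormal_basis_fock_basis:
  assumes \<alpha>: "0 < \<alpha>"
  shows "fock_orthonormal_basis \<alpha> (fock_basis \<alpha>)"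
  unfolding fock_orthonormal_basis_def
proof (intro conjI allI ballI impI)
  show mem: "fock_basis \<alpha> k \<in> fock_space \<alpha>" for k
    unfolding fock_basis_eq by (rule fock_space_monomial[OF \<alpha>])
  fix j k
  have "fock_inner \<alpha> (fock_basis \<alpha> j) (fock_basis \<alpha> k) = (1 / complex_of_real (fock_coeff \<alpha> j)) *
      cnj (if j = k then 1 / complex_of_real (fock_coeff \<alpha> k) else 0) * complex_of_real ((fock_coeff \<alpha> j)\<^sup>2)"
    using fock_inner_monomial[OF \<alpha> mem[unfolded fock_basis_eq] entire_series_monomial]
    unfolding fock_basis_eq by blast
  then show "fock_inner \<alpha> (fock_basis \<alpha> j) (fock_basis \<alpha> k) = (if j = k then 1 else 0)"
    using fock_coeff_pos[OF \<alpha>, of k] by (auto simp: power2_eq_square)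
next
  fix f \<epsilon> assume f: "f \<in> fock_space \<alpha>" and \<epsilon>: "(0::real) < \<epsilon>"
  obtain a where ser: "entire_series a f" using f by (rule fock_space_entire_series)
  have "(\<lambda>n. fock_norm \<alpha> (\<lambda>z. f z - (\<Sum>k<n. a k * z ^ k))) \<longlonglongrightarrow> 0"
    using fock_sums_power_series[OF \<alpha> f ser] by (simp add: fock_sums_def)
  then have "\<forall>\<^sub>F n in sequentially. fock_norm \<alpha> (\<lambda>z. f z - (\<Sum>k<n. a k * z ^ k)) < \<epsilon>"
    using \<epsilon> by (rule order_tendstoD)
  then obtain n where n: "fock_norm \<alpha> (\<lambda>z. f z - (\<Sum>k<n. a k * z ^ k)) < \<epsilon>"
    by (auto simp: eventually_sequentially)
  have nz: "fock_coeff \<alpha> k \<noteq> 0" for k using fock_coeff_pos[OF \<alpha>, of k] by simp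
  \<comment> \<open>The factor \<open>fock_coeff \<alpha> k\<close> converts a coefficient of a
    monomial into one of the normalised basis function.\<close>
  show "\<exists>n b. fock_norm \<alpha> (\<lambda>z. f z - (\<Sum>k<n. b k * fock_basis \<alpha> k z)) < \<epsilon>"
    by (rule exI[of _ n], rule exI[of _ "\<lambda>k. a k * fock_coeff \<alpha> k"])
       (use n nz in \<open>simp add: fock_basis_def\<close>)
qed

text \<open>Monomials as test functions recover every Taylor coefficient of the right argument. This
  is the uniqueness demanded by the definite description in \<open>fock_adjoint\<close>.\<close>

lemma fock_inner_right_unique:
  assumes \<alpha>: "0 < \<alpha>" and h: "h \<in> fock_space \<alpha>" "k \<in> fock_space \<alpha>"
    and eq: "\<And>f. f \<in> fock_space \<alpha> \<Longrightarrow> fock_inner \<alpha> f h = fock_inner \<alpha> f k"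
  shows "h = k"
proof -
  obtain a where sh: "entire_series a h" using h(1) by (rule fock_space_entire_series)
  obtain b where sk: "entire_series b k" using h(2) by (rule fock_space_entire_series)
  have "a n = b n" for n
    using eq[OF fock_space_monomial[OF \<alpha>, of 1 n]] fock_coeff_pos[OF \<alpha>, of n]
    unfolding fock_inner_monomial[OF \<alpha> h(1) sh] fock_inner_monomial[OF \<alpha> h(2) sk] by simp
  then have "a = b" by blast
  then show ?thesis using entire_series_unique sh sk by blast
qed

subsection \<open>The derivative and its adjoint\<close>

context
  fixes \<alpha> \<beta> :: real
  assumes \<alpha>: "0 < \<alpha>" and \<alpha>\<beta>: "\<alpha> < \<beta>"
begin

lemma beta_pos: "0 < \<beta>" using \<alpha> \<alpha>\<beta> by simp

text \<open>Since \<alpha> / \<beta> < 1, geometric decay beats the linear factor. The bound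
  \<open>K\<close> gives both the boundedness of the derivative and the membership of the adjoint
  image.\<close>

lemma fock_weight_ratio_bounded:
  obtains K where "0 \<le> K" "\<And>n. real (Suc n) * \<alpha> * (\<alpha> / \<beta>) ^ n \<le> K"
proof -
  have "(\<lambda>n. real n * (\<alpha> / \<beta>) ^ n) \<longlonglongrightarrow> 0"
    using \<alpha> \<alpha>\<beta> by (intro powser_times_n_limit_0) auto
  then have "Bseq (\<lambda>n. real n * (\<alpha> / \<beta>) ^ n)"
    by (intro convergent_imp_Bseq convergentI)
  then obtain K where K: "0 < K" "\<And>n. norm (real n * (\<alpha> / \<beta>) ^ n) \<le> K"
    by (auto simp: Bseq_def)
  \<comment> \<open>The bound at index \<open>Suc n\<close> carries one more factor
    \<open>\<alpha> / \<beta>\<close>; multiplying by \<open>\<beta>\<close> restores the wanted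
    expression.\<close>
  have "real (Suc n) * \<alpha> * (\<alpha> / \<beta>) ^ n \<le> K * \<beta>" for n
    using K(2)[of "Suc n"] \<alpha> beta_pos by (simp add: field_simps)
  then show ?thesis using K(1) beta_pos by (intro that[of "K * \<beta>"]) auto
qed

lemma deriv_coeff_weight:
  "(norm (of_nat (Suc n) * c :: complex))\<^sup>2 * (fock_coeff \<beta> n)\<^sup>2
     = (real (Suc n) * \<alpha> * (\<alpha> / \<beta>) ^ n) * ((norm c)\<^sup>2 * (fock_coeff \<alpha> (Suc n))\<^sup>2)"
proof -
  have "norm (of_nat (Suc n) * c :: complex) = real (Suc n) * norm c"
    by (simp only: norm_mult norm_of_nat)
  moreover have "(real (Suc n))\<^sup>2 * (fact n / \<beta> ^ n) =
     (real (Suc n) * \<alpha> * (\<alpha> / \<beta>) ^ n) * (fact (Suc n) / \<alpha> ^ Suc n)"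
    using \<alpha> beta_pos by (simp add: power_divide divide_simps) (simp add: power2_eq_square algebra_simps)
  ultimately show ?thesis
    by (simp only: power_mult_distrib fock_coeff_square[OF \<alpha>] fock_coeff_square[OF beta_pos]) (simp add: ac_simps)
qed

lemma
  assumes f: "f \<in> fock_space \<alpha>"
    and K: "0 \<le> K" "\<And>n. real (Suc n) * \<alpha> * (\<alpha> / \<beta>) ^ n \<le> K"
  shows deriv_mem_fock_space: "deriv f \<in> fock_space \<beta>"
    and fock_norm_deriv_le: "fock_norm \<beta> (deriv f) \<le> sqrt K * fock_norm \<alpha> f"
proof -
  obtain a where ser: "entire_series a f" using f by (rule fock_space_entire_series)
  let ?A = "\<lambda>n. (norm (a n))\<^sup>2 * (fock_coeff \<alpha> n)\<^sup>2"
  let ?D = "\<lambda>n. (norm (of_nat (Suc n) * a (Suc n)))\<^sup>2 * (fock_coeff \<beta> n)\<^sup>2"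
  note A = fock_norm_square_sums[OF \<alpha> f ser]
  have le: "?D n \<le> K * ?A (Suc n)" for n
    unfolding deriv_coeff_weight by (intro mult_right_mono K) auto
  \<comment> \<open>Differentiation kills the constant term, so its share of the squared norm is
    split off and dropped in the final estimate.\<close>
  have A1: "(\<lambda>n. ?A (Suc n)) sums ((fock_norm \<alpha> f)\<^sup>2 - ?A 0)"
    using A by (subst sums_Suc_iff) simp
  have "summable ?D"
    using le by (intro summable_comparison_test'[OF summable_mult[OF sums_summable[OF A1], of K]]) auto
  then show mem: "deriv f \<in> fock_space \<beta>"
    using fock_space_iff_summable[OF entire_series_deriv[OF ser] beta_pos] by simp
  have "(fock_norm \<beta> (deriv f))\<^sup>2 \<le> K * ((fock_norm \<alpha> f)\<^sup>2 - ?A 0)"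
    by (rule sums_le[OF le fock_norm_square_sums[OF beta_pos mem entire_series_deriv[OF ser]] sums_mult[OF A1]])
  also have "\<dots> \<le> K * (fock_norm \<alpha> f)\<^sup>2"
    using K(1) by (intro mult_left_mono) auto
  finally have "sqrt ((fock_norm \<beta> (deriv f))\<^sup>2) \<le> sqrt (K * (fock_norm \<alpha> f)\<^sup>2)"
    by (rule real_sqrt_le_mono)
  moreover have "0 \<le> fock_norm \<alpha> f"
    by (rule fock_norm_nonneg[OF \<alpha> f ser])
  ultimately show "fock_norm \<beta> (deriv f) \<le> sqrt K * fock_norm \<alpha> f"
    by (simp add: real_sqrt_mult)
qed

lemma fock_bounded_operator_deriv: "fock_bounded_operator \<alpha> \<beta> deriv"
proof -
  obtain K where K: "0 \<le> K" "\<And>n. real (Suc n) * \<alpha> * (\<alpha> / \<beta>) ^ n \<le> K"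
    using fock_weight_ratio_bounded by blast
  have dif: "f field_differentiable (at z)" if "f \<in> fock_space \<alpha>" for f z
    using that by (auto simp: fock_space_def holomorphic_on_def)
  show ?thesis
    unfolding fock_bounded_operator_def
    using deriv_mem_fock_space[OF _ K] fock_norm_deriv_le[OF _ K] by (auto simp: dif)
qed

text \<open>The solution of the coefficient equations imposed by the adjoint relation; the value 0
  at index 0 reflects that every derivative ignores the constant term.\<close>

definition adjoint_coeff :: "(nat \<Rightarrow> complex) \<Rightarrow> nat \<Rightarrow> complex" where
  "adjoint_coeff b n = (case n of 0 \<Rightarrow> 0 | Suc m \<Rightarrow> complex_of_real (\<alpha> ^ Suc m / \<beta> ^ m) * b m)"

text \<open>The factor z shifts the coefficients by one place, and the dilation by \<alpha> /
  \<beta> supplies the geometric factor.\<close>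

lemma entire_series_adjoint:
  assumes "entire_series b g"
  shows "entire_series (adjoint_coeff b) (\<lambda>z. complex_of_real \<alpha> * z * g (complex_of_real (\<alpha> / \<beta>) * z))"
  unfolding entire_series_def
proof
  fix z :: complex
  have s: "(\<lambda>n. complex_of_real \<alpha> * z * (b n * (complex_of_real (\<alpha> / \<beta>) * z) ^ n)) sums
      (complex_of_real \<alpha> * z * g (complex_of_real (\<alpha> / \<beta>) * z))"
    by (intro sums_mult entire_series_sums assms)
  have e: "complex_of_real \<alpha> * z * (b n * (complex_of_real (\<alpha> / \<beta>) * z) ^ n)
     = adjoint_coeff b (Suc n) * z ^ Suc n" for n
    by (simp add: adjoint_coeff_def power_mult_distrib power_divide)
  show "(\<lambda>n. adjoint_coeff b n * z ^ n) sums
      (complex_of_real \<alpha> * z * g (complex_of_real (\<alpha> / \<beta>) * z))"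
    using s[unfolded e] by (subst (asm) sums_Suc_iff) (simp add: adjoint_coeff_def)
qed

text \<open>The factor is the same as in \<open>deriv_coeff_weight\<close>, as it must be: an
  operator and its adjoint share their nonzero singular values.\<close>

lemma adjoint_coeff_weight:
  "(norm (adjoint_coeff b (Suc n)))\<^sup>2 * (fock_coeff \<alpha> (Suc n))\<^sup>2
    = (real (Suc n) * \<alpha> * (\<alpha> / \<beta>) ^ n) * ((norm (b n))\<^sup>2 * (fock_coeff \<beta> n)\<^sup>2)"
proof -
  have "norm (adjoint_coeff b (Suc n)) = \<alpha> ^ Suc n / \<beta> ^ n * norm (b n)"
    unfolding adjoint_coeff_def using \<alpha> beta_pos by (simp add: norm_mult norm_divide norm_power)
  moreover have "(\<alpha> ^ Suc n / \<beta> ^ n)\<^sup>2 * (fact (Suc n) / \<alpha> ^ Suc n) =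
     (real (Suc n) * \<alpha> * (\<alpha> / \<beta>) ^ n) * (fact n / \<beta> ^ n)"
    using \<alpha> beta_pos by (simp add: power_divide divide_simps) (simp add: power2_eq_square algebra_simps)
  ultimately show ?thesis
    by (simp only: power_mult_distrib fock_coeff_square[OF \<alpha>] fock_coeff_square[OF beta_pos]) (simp add: ac_simps)
qed

lemma adjoint_mem_fock_space:
  assumes g: "g \<in> fock_space \<beta>"
  shows "(\<lambda>z. complex_of_real \<alpha> * z * g (complex_of_real (\<alpha> / \<beta>) * z)) \<in> fock_space \<alpha>"
proof -
  obtain K where K: "0 \<le> K" "\<And>n. real (Suc n) * \<alpha> * (\<alpha> / \<beta>) ^ n \<le> K"
    using fock_weight_ratio_bounded by blast
  obtain b where ser: "entire_series b g" using g by (rule fock_space_entire_series)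
  have sum: "summable (\<lambda>n. (norm (b n))\<^sup>2 * (fock_coeff \<beta> n)\<^sup>2)"
    using fock_space_iff_summable[OF ser beta_pos] g by simp
  have "(norm (adjoint_coeff b (Suc n)))\<^sup>2 * (fock_coeff \<alpha> (Suc n))\<^sup>2
      \<le> K * ((norm (b n))\<^sup>2 * (fock_coeff \<beta> n)\<^sup>2)" for n
    unfolding adjoint_coeff_weight by (intro mult_right_mono K) auto
  then have "summable (\<lambda>n. (norm (adjoint_coeff b (Suc n)))\<^sup>2 * (fock_coeff \<alpha> (Suc n))\<^sup>2)"
    by (intro summable_comparison_test'[OF summable_mult[OF sum, of K]]) auto
  then have "summable (\<lambda>n. (norm (adjoint_coeff b n))\<^sup>2 * (fock_coeff \<alpha> n)\<^sup>2)"
    by (subst (asm) summable_Suc_iff)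
  then show ?thesis
    using fock_space_iff_summable[OF entire_series_adjoint[OF ser] \<alpha>] by simp
qed

lemma fock_inner_deriv:
  assumes f: "f \<in> fock_space \<alpha>" and g: "g \<in> fock_space \<beta>"
  shows "fock_inner \<beta> (deriv f) g =
    fock_inner \<alpha> f (\<lambda>z. complex_of_real \<alpha> * z * g (complex_of_real (\<alpha> / \<beta>) * z))"
    (is "_ = fock_inner \<alpha> f ?h")
proof -
  obtain K where K: "0 \<le> K" "\<And>n. real (Suc n) * \<alpha> * (\<alpha> / \<beta>) ^ n \<le> K"
    using fock_weight_ratio_bounded by blast
  obtain a where sf: "entire_series a f" using f by (rule fock_space_entire_series)
  obtain b where sg: "entire_series b g" using g by (rule fock_space_entire_series)
  let ?t = "\<lambda>n. a n * cnj (adjoint_coeff b n) * complex_of_real ((fock_coeff \<alpha> n)\<^sup>2)"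
  have "?t sums fock_inner \<alpha> f ?h"
    by (rule fock_inner_sums[OF \<alpha> f adjoint_mem_fock_space[OF g] sf entire_series_adjoint[OF sg]])
  \<comment> \<open>The term at index 0 vanishes, so the series may be shifted and compared term by
    term with the one for \<open>deriv f\<close>.\<close>
  then have s: "(\<lambda>n. ?t (Suc n)) sums fock_inner \<alpha> f ?h"
    by (subst sums_Suc_iff) (simp add: adjoint_coeff_def)
  have t: "?t (Suc n) = of_nat (Suc n) * a (Suc n) * cnj (b n) * complex_of_real ((fock_coeff \<beta> n)\<^sup>2)" for n
  proof -
    \<comment> \<open>This balance of weights is the equation that determines
      \<open>adjoint_coeff\<close>.\<close>
    have "\<alpha> ^ Suc n / \<beta> ^ n * (fock_coeff \<alpha> (Suc n))\<^sup>2 = real (Suc n) * (fock_coeff \<beta> n)\<^sup>2"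
      unfolding fock_coeff_square[OF \<alpha>] fock_coeff_square[OF beta_pos] using \<alpha> beta_pos by simp
    then have "complex_of_real (\<alpha> ^ Suc n / \<beta> ^ n) * complex_of_real ((fock_coeff \<alpha> (Suc n))\<^sup>2)
        = of_nat (Suc n) * complex_of_real ((fock_coeff \<beta> n)\<^sup>2)"
      by (metis of_real_mult of_real_of_nat_eq)
    note e = this
    have "?t (Suc n) = a (Suc n) * cnj (b n) *
        (complex_of_real (\<alpha> ^ Suc n / \<beta> ^ n) * complex_of_real ((fock_coeff \<alpha> (Suc n))\<^sup>2))"
      by (simp only: adjoint_coeff_def nat.case complex_cnj_mult complex_cnj_complex_of_real ac_simps)
    then show ?thesis
      unfolding e by (simp only: ac_simps)
  qed
  have "(\<lambda>n. of_nat (Suc n) * a (Suc n) * cnj (b n) * complex_of_real ((fock_coeff \<beta> n)\<^sup>2)) sums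
      fock_inner \<beta> (deriv f) g"
    by (rule fock_inner_sums[OF beta_pos deriv_mem_fock_space[OF f K] g entire_series_deriv[OF sf] sg])
  then show ?thesis
    using s unfolding t by (rule sums_unique2)
qed

text \<open>The closed form is an explicit witness for the definite description, and testing on
  monomials shows that it is the only one.\<close>

lemma fock_adjoint_deriv:
  assumes g: "g \<in> fock_space \<beta>"
  shows "fock_adjoint \<alpha> \<beta> deriv g = (\<lambda>z. complex_of_real \<alpha> * z * g (complex_of_real (\<alpha> / \<beta>) * z))"
  unfolding fock_adjoint_def
proof (rule the_equality, intro conjI ballI)
  fix h assume h: "h \<in> fock_space \<alpha> \<and> (\<forall>f \<in> fock_space \<alpha>. fock_inner \<beta> (deriv f) g = fock_inner \<alpha> f h)"
  then show "h = (\<lambda>z. complex_of_real \<alpha> * z * g (complex_of_real (\<alpha> / \<beta>) * z))"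
    by (intro fock_inner_right_unique[OF \<alpha>] adjoint_mem_fock_space[OF g])
       (auto simp only: fock_inner_deriv[OF _ g, symmetric])
qed (use g adjoint_mem_fock_space fock_inner_deriv in auto)

text \<open>Of the two factors 1 / c_k, one stands in the asserted coefficient and the other comes
  from e_k. Together they give the square of c_k, while the hypothesis on \<open>b\<close> turns
  d_{k-1} into d_{k-1}^2 / d_{k-1}, so the square roots disappear.\<close>

lemma adjoint_coeff_fock_basis:
  assumes "\<And>n. b n = \<gamma> n / complex_of_real (fock_coeff \<beta> n)"
  shows "(if k = 0 then 0
     else of_nat k * complex_of_real (fock_coeff \<beta> (k - 1) / fock_coeff \<alpha> k) * \<gamma> (k - 1) * fock_basis \<alpha> k z)
     = adjoint_coeff b k * z ^ k"
proof (cases k)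
  case (Suc m)
  have "real (Suc m) * (fock_coeff \<beta> m / fock_coeff \<alpha> (Suc m)) / fock_coeff \<alpha> (Suc m)
      = real (Suc m) * (fock_coeff \<beta> m)\<^sup>2 / (fock_coeff \<alpha> (Suc m))\<^sup>2 / fock_coeff \<beta> m"
    using fock_coeff_pos[OF beta_pos, of m] by (simp add: power2_eq_square)
  also have "real (Suc m) * (fock_coeff \<beta> m)\<^sup>2 / (fock_coeff \<alpha> (Suc m))\<^sup>2 = \<alpha> ^ Suc m / \<beta> ^ m"
    unfolding fock_coeff_square[OF \<alpha>] fock_coeff_square[OF beta_pos] using \<alpha> beta_pos by (simp add: divide_simps)
  finally have "complex_of_real (real (Suc m) * (fock_coeff \<beta> m / fock_coeff \<alpha> (Suc m)) / fock_coeff \<alpha> (Suc m))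
      = complex_of_real (\<alpha> ^ Suc m / \<beta> ^ m / fock_coeff \<beta> m)" by (rule arg_cong)
  then have e: "of_nat (Suc m) * complex_of_real (fock_coeff \<beta> m / fock_coeff \<alpha> (Suc m)) / complex_of_real (fock_coeff \<alpha> (Suc m))
      = complex_of_real (\<alpha> ^ Suc m / \<beta> ^ m) / complex_of_real (fock_coeff \<beta> m)"
    by (simp only: of_real_mult of_real_divide of_real_of_nat_eq)
  have "of_nat (Suc m) * complex_of_real (fock_coeff \<beta> m / fock_coeff \<alpha> (Suc m)) * \<gamma> m * fock_basis \<alpha> (Suc m) z
     = (of_nat (Suc m) * complex_of_real (fock_coeff \<beta> m / fock_coeff \<alpha> (Suc m)) / complex_of_real (fock_coeff \<alpha> (Suc m))) * \<gamma> m * z ^ Suc m"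
    by (simp add: fock_basis_def)
  then show ?thesis
    unfolding e by (simp add: Suc adjoint_coeff_def assms)
qed (simp add: adjoint_coeff_def)

end

theorem mainTheorem6:
  fixes \<alpha> \<beta> :: real
  assumes "0 < \<alpha>" and "\<alpha> < \<beta>"
  shows "fock_bounded_operator \<alpha> \<beta> deriv \<and>
    fock_orthonormal_basis \<alpha> (fock_basis \<alpha>) \<and>
    fock_orthonormal_basis \<beta> (fock_basis \<beta>) \<and>
    (\<forall>g \<in> fock_space \<beta>. fock_adjoint \<alpha> \<beta> deriv g \<in> fock_space \<alpha> \<and>
       (\<forall>f \<in> fock_space \<alpha>.
          fock_inner \<beta> (deriv f) g = fock_inner \<alpha> f (fock_adjoint \<alpha> \<beta> deriv g))) \<and>
    (\<forall>(\<gamma> :: nat \<Rightarrow> complex) g.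
       summable (\<lambda>k. (norm (\<gamma> k))\<^sup>2) \<longrightarrow>
       g \<in> fock_space \<beta> \<longrightarrow>
       fock_sums \<beta> (\<lambda>k z. \<gamma> k * fock_basis \<beta> k z) g \<longrightarrow>
       fock_sums \<alpha>
         (\<lambda>k z. if k = 0 then 0
                else of_nat k * complex_of_real (fock_coeff \<beta> (k - 1) / fock_coeff \<alpha> k)
                     * \<gamma> (k - 1) * fock_basis \<alpha> k z)
         (fock_adjoint \<alpha> \<beta> deriv g))"
proof (intro conjI ballI allI impI)
  have \<beta>: "0 < \<beta>" using assms by simp
  show "fock_bounded_operator \<alpha> \<beta> deriv"
    by (rule fock_bounded_operator_deriv[OF assms])
  show "fock_orthonormal_basis \<alpha> (fock_basis \<alpha>)" "fock_orthonormal_basis \<beta> (fock_basis \<beta>)"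
    using assms \<beta> by (auto intro: fock_orthonormal_basis_fock_basis)
  fix g assume g: "g \<in> fock_space \<beta>"
  show mem: "fock_adjoint \<alpha> \<beta> deriv g \<in> fock_space \<alpha>"
    unfolding fock_adjoint_deriv[OF assms g] by (rule adjoint_mem_fock_space[OF assms g])
  show "fock_inner \<beta> (deriv f) g = fock_inner \<alpha> f (fock_adjoint \<alpha> \<beta> deriv g)"
    if "f \<in> fock_space \<alpha>" for f
    unfolding fock_adjoint_deriv[OF assms g] by (rule fock_inner_deriv[OF assms that g])
  fix \<gamma> :: "nat \<Rightarrow> complex"
  assume sums: "fock_sums \<beta> (\<lambda>k z. \<gamma> k * fock_basis \<beta> k z) g"
  obtain b where ser: "entire_series b g" using g by (rule fock_space_entire_series)
  \<comment> \<open>The given expansion converges only in norm; rewriting it in monomials allows its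
    coefficients to be identified with the Taylor coefficients of \<open>g\<close>.\<close>
  have "fock_sums \<beta> (\<lambda>k z. (\<gamma> k / complex_of_real (fock_coeff \<beta> k)) * z ^ k) g"
    using sums by (simp add: fock_basis_def)
  then have "b = (\<lambda>k. \<gamma> k / complex_of_real (fock_coeff \<beta> k))"
    by (rule fock_sums_coefficients[OF \<beta> ser, symmetric])
  then show "fock_sums \<alpha>
         (\<lambda>k z. if k = 0 then 0
                else of_nat k * complex_of_real (fock_coeff \<beta> (k - 1) / fock_coeff \<alpha> k)
                     * \<gamma> (k - 1) * fock_basis \<alpha> k z)
         (fock_adjoint \<alpha> \<beta> deriv g)"
    using fock_sums_power_series[OF assms(1) adjoint_mem_fock_space[OF assms g] entire_series_adjoint[OF assms ser]]
    by (simp only: adjoint_coeff_fock_basis[OF assms, of b] fock_adjoint_deriv[OF assms g])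
qed

end
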